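(* Let $F_1,F_2,F_3$ be symmetric distribution functions, let $U\sim U[0,1]$, and let $G_i$ be the distribution function of $|(X_i-\mu_i)/\sigma_i|$ when $X_i\sim F_i$, $i=1,2,3$. Let $V\sim U[0,1]$ be independent of $U$, $I=\mathbf{1}_{U>1/2}$ and $J=\mathbf{1}_{V>1/2}$. The maximum coskewness under dependence uncertainty is $$\overline{S}=\mathbb{E}\left(G_1^{-1}(U)G_2^{-1}(U)G_3^{-1}(U)\right),$$ and it is attained when $X_i=F_i^{-1}(U_i)$ with $$\begin{aligned}U_1&=U,\\ U_2&=IJU+I(1-J)(1-U)+(1-I)JU+(1-I)(1-J)(1-U),\\ U_3&=IJU+I(1-J)(1-U)+(1-I)J(1-U)+(1-I)(1-J)U.\end{aligned}$$ The minimum coskewness under dependence uncertainty is $$\underline{S}=-\mathbb{E}\left(G_1^{-1}(U)G_2^{-1}(U)G_3^{-1}(U)\right),$$ and it is attained when $X_i=F_i^{-1}(U_i)$ with $$\begin{aligned}U_1&=U,\\ U_2&=IJU+I(1-J)(1-U)+(1-I)JU+(1-I)(1-J)(1-U),\\ U_3&=IJ(1-U)+I(1-J)U+(1-I)JU+(1-I)(1-J)(1-U).\end{aligned}$$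
   Context: All random variables $X_i\sim F_i$ are square integrable, with means $\mu_i$ and standard deviations $\sigma_i>0$. $X\sim F$ means that $X$ has distribution function $F$, and $F^{-1}$ is the (generalized, left-continuous) inverse, i.e. the quantile function, of $F$. $F_i$ is symmetric if $X_i-\mu_i$ and $\mu_i-X_i$ have the same distribution for $X_i\sim F_i$. The coskewness of $X_1,X_2,X_3$ is $$S(X_1,X_2,X_3)=\frac{\mathbb{E}\left((X_1-\mu_1)(X_2-\mu_2)(X_3-\mu_3)\right)}{\sigma_1\sigma_2\sigma_3}.$$ $\overline{S}$ and $\underline{S}$ denote the supremum and infimum, respectively, of $S(X_1,X_2,X_3)$ over all random vectors $(X_1,X_2,X_3)$ with $X_i\sim F_i$, $i=1,2,3$, and arbitrary dependence, for which the expectation is well defined (in $[-\infty,\infty]$). *)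

theory Defs
  imports "HOL-Probability.Probability"
begin

definition distribution_function :: "(real \<Rightarrow> real) \<Rightarrow> bool" where
  "distribution_function F \<longleftrightarrow>
     mono F \<and> (\<forall>a. continuous (at_right a) F) \<and> (F \<longlongrightarrow> 0) at_bot \<and> (F \<longlongrightarrow> 1) at_top"

definition has_distribution :: "'a measure \<Rightarrow> ('a \<Rightarrow> real) \<Rightarrow> (real \<Rightarrow> real) \<Rightarrow> bool" where
  "has_distribution P X F \<longleftrightarrow> X \<in> borel_measurable P \<and> cdf (distr P borel X) = F"

text \<open>
  For a distribution function \<open>F\<close>, \<open>interval_measure F\<close> is the law on the real line with
  distribution function \<open>F\<close>; properties of \<open>X \<sim> F\<close> that depend on the law only are
  expressed through it.
\<close>

definition square_integrable_df :: "(real \<Rightarrow> real) \<Rightarrow> bool" where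
  "square_integrable_df F \<longleftrightarrow> integrable (interval_measure F) (\<lambda>x. x\<^sup>2)"

definition df_mean :: "(real \<Rightarrow> real) \<Rightarrow> real" where
  "df_mean F = (LINT x|interval_measure F. x)"

definition df_sd :: "(real \<Rightarrow> real) \<Rightarrow> real" where
  "df_sd F = sqrt (LINT x|interval_measure F. (x - df_mean F)\<^sup>2)"

definition symmetric_df :: "(real \<Rightarrow> real) \<Rightarrow> bool" where
  "symmetric_df F \<longleftrightarrow>
     distr (interval_measure F) borel (\<lambda>x. x - df_mean F) =
     distr (interval_measure F) borel (\<lambda>x. df_mean F - x)"

definition abs_standardized_df :: "(real \<Rightarrow> real) \<Rightarrow> real \<Rightarrow> real" where
  "abs_standardized_df F =
     cdf (distr (interval_measure F) borel (\<lambda>x. \<bar>(x - df_mean F) / df_sd F\<bar>))"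

text \<open>
  The left-continuous generalized inverse. It is meaningful for \<open>0 < u < 1\<close>; outside this
  interval the defining set may be empty or unbounded below and the real-valued \<open>Inf\<close>
  is then an arbitrary number. Below, \<open>quantile\<close> is only applied to uniform random variables,
  so that these arguments have probability zero.
\<close>

definition quantile :: "(real \<Rightarrow> real) \<Rightarrow> real \<Rightarrow> real" where
  "quantile F u = Inf {x. u \<le> F x}"

text \<open>
  Expectations with values in \<open>[-\<infinity>, \<infinity>]\<close>: the difference of the expectations of the positive and
  the negative part, well defined unless both are infinite.
\<close>

definition expectation_well_defined :: "'a measure \<Rightarrow> ('a \<Rightarrow> real) \<Rightarrow> bool" where
  "expectation_well_defined P f \<longleftrightarrow> f \<in> borel_measurable P \<and>
     ((\<integral>\<^sup>+\<omega>. ennreal (f \<omega>) \<partial>P) \<noteq> \<infinity> \<or> (\<integral>\<^sup>+\<omega>. ennreal (- f \<omega>) \<partial>P) \<noteq> \<infinity>)"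

definition ext_expectation :: "'a measure \<Rightarrow> ('a \<Rightarrow> real) \<Rightarrow> ereal" where
  "ext_expectation P f =
     enn2ereal (\<integral>\<^sup>+\<omega>. ennreal (f \<omega>) \<partial>P) - enn2ereal (\<integral>\<^sup>+\<omega>. ennreal (- f \<omega>) \<partial>P)"

lemma ext_expectation_integrable:
  assumes "integrable P f"
  shows "expectation_well_defined P f" "ext_expectation P f = ereal (LINT \<omega>|P. f \<omega>)"
proof -
  have pos: "(\<integral>\<^sup>+\<omega>. ennreal (f \<omega>) \<partial>P) \<noteq> \<infinity>" and neg: "(\<integral>\<^sup>+\<omega>. ennreal (- f \<omega>) \<partial>P) \<noteq> \<infinity>"
    using assms by (auto simp: real_integrable_def)
  show "expectation_well_defined P f"
    using assms pos by (auto simp: expectation_well_defined_def)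
  show "ext_expectation P f = ereal (LINT \<omega>|P. f \<omega>)"
    unfolding ext_expectation_def real_lebesgue_integral_def[OF assms] using pos neg
    by (metis enn2ereal_ennreal enn2real_nonneg ennreal_enn2real infinity_ennreal_def
        ereal_minus(1) top.not_eq_extremum)
qed

definition std_dev :: "'a measure \<Rightarrow> ('a \<Rightarrow> real) \<Rightarrow> real" where
  "std_dev P X = sqrt (prob_space.variance P X)"

definition centred_product ::
    "'a measure \<Rightarrow> ('a \<Rightarrow> real) \<Rightarrow> ('a \<Rightarrow> real) \<Rightarrow> ('a \<Rightarrow> real) \<Rightarrow> 'a \<Rightarrow> real" where
  "centred_product P X1 X2 X3 \<omega> =
     (X1 \<omega> - prob_space.expectation P X1) * (X2 \<omega> - prob_space.expectation P X2) *
     (X3 \<omega> - prob_space.expectation P X3)"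

definition coskewness ::
    "'a measure \<Rightarrow> ('a \<Rightarrow> real) \<Rightarrow> ('a \<Rightarrow> real) \<Rightarrow> ('a \<Rightarrow> real) \<Rightarrow> ereal" where
  "coskewness P X1 X2 X3 =
     ext_expectation P (centred_product P X1 X2 X3) /
     ereal (std_dev P X1 * std_dev P X2 * std_dev P X3)"

definition admissible ::
    "(real \<Rightarrow> real) \<Rightarrow> (real \<Rightarrow> real) \<Rightarrow> (real \<Rightarrow> real) \<Rightarrow>
     'a measure \<Rightarrow> ('a \<Rightarrow> real) \<Rightarrow> ('a \<Rightarrow> real) \<Rightarrow> ('a \<Rightarrow> real) \<Rightarrow> bool" where
  "admissible F1 F2 F3 P X1 X2 X3 \<longleftrightarrow>
     prob_space P \<and>
     has_distribution P X1 F1 \<and> has_distribution P X2 F2 \<and> has_distribution P X3 F3 \<and>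
     expectation_well_defined P (centred_product P X1 X2 X3)"

text \<open>
  A set cannot range over probability spaces of all types. The sample spaces here are arbitrary
  probability spaces on the type \<open>real \<times> real \<times> real\<close>; by the lemma
  \<open>admissible_imp_coskewness_value\<close> below this loses nothing, since every random vector can be
  replaced by the coordinate vector under its joint law.
\<close>

definition coskewness_values ::
    "(real \<Rightarrow> real) \<Rightarrow> (real \<Rightarrow> real) \<Rightarrow> (real \<Rightarrow> real) \<Rightarrow> ereal set" where
  "coskewness_values F1 F2 F3 =
     {coskewness P X1 X2 X3 | (P :: (real \<times> real \<times> real) measure) X1 X2 X3.
        admissible F1 F2 F3 P X1 X2 X3}"

lemma admissible_imp_coskewness_value:
  fixes P :: "'a measure"
  assumes "admissible F1 F2 F3 P X1 X2 X3"
  shows "coskewness P X1 X2 X3 \<in> coskewness_values F1 F2 F3"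
proof -
  interpret prob_space P
    using assms by (simp add: admissible_def)
  have m [measurable]: "X1 \<in> borel_measurable P" "X2 \<in> borel_measurable P" "X3 \<in> borel_measurable P"
    using assms by (auto simp: admissible_def has_distribution_def)
  define T where "T = (\<lambda>\<omega>. (X1 \<omega>, X2 \<omega>, X3 \<omega>))"
  define Y1 Y2 Y3 :: "real \<times> real \<times> real \<Rightarrow> real"
    where "Y1 = fst" and "Y2 = (\<lambda>x. fst (snd x))" and "Y3 = (\<lambda>x. snd (snd x))"
  have mY [measurable]: "Y1 \<in> borel_measurable borel" "Y2 \<in> borel_measurable borel"
      "Y3 \<in> borel_measurable borel"
    unfolding Y1_def Y2_def Y3_def borel_prod[symmetric] by measurable
  have mT [measurable]: "T \<in> P \<rightarrow>\<^sub>M borel"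
    unfolding T_def borel_prod[symmetric] by measurable
  define Q where "Q = distr P borel T"
  have YT: "Y1 (T \<omega>) = X1 \<omega>" "Y2 (T \<omega>) = X2 \<omega>" "Y3 (T \<omega>) = X3 \<omega>" for \<omega>
    by (simp_all add: Y1_def Y2_def Y3_def T_def)
  have Qs [measurable_cong]: "sets Q = sets borel"
    by (simp add: Q_def)
  have Q: "prob_space Q"
    unfolding Q_def by (rule prob_space_distr) measurable
  have D: "distr Q borel Y1 = distr P borel X1" "distr Q borel Y2 = distr P borel X2"
      "distr Q borel Y3 = distr P borel X3"
    by (simp_all add: Q_def distr_distr comp_def YT)
  have E: "integral\<^sup>L Q Y1 = integral\<^sup>L P X1" "integral\<^sup>L Q Y2 = integral\<^sup>L P X2"
      "integral\<^sup>L Q Y3 = integral\<^sup>L P X3"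
    by (simp_all add: Q_def integral_distr YT)
  have S: "std_dev Q Y1 = std_dev P X1" "std_dev Q Y2 = std_dev P X2" "std_dev Q Y3 = std_dev P X3"
    unfolding std_dev_def E by (simp_all add: Q_def integral_distr YT)
  have mC: "centred_product Q Y1 Y2 Y3 \<in> borel_measurable borel"
    unfolding centred_product_def by measurable
  have C: "centred_product Q Y1 Y2 Y3 (T \<omega>) = centred_product P X1 X2 X3 \<omega>" for \<omega>
    by (simp add: centred_product_def E YT)
  have N: "(\<integral>\<^sup>+x. ennreal (centred_product Q Y1 Y2 Y3 x) \<partial>Q) =
        (\<integral>\<^sup>+\<omega>. ennreal (centred_product P X1 X2 X3 \<omega>) \<partial>P)"
      "(\<integral>\<^sup>+x. ennreal (- centred_product Q Y1 Y2 Y3 x) \<partial>Q) =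
        (\<integral>\<^sup>+\<omega>. ennreal (- centred_product P X1 X2 X3 \<omega>) \<partial>P)"
    using mC by (simp_all add: C[symmetric] nn_integral_distr[OF mT] Q_def)
  have "admissible F1 F2 F3 Q Y1 Y2 Y3"
    using assms Q mC Qs mY unfolding admissible_def has_distribution_def expectation_well_defined_def D N
    by (simp add: measurable_cong_sets[OF Qs refl])
  moreover have "coskewness Q Y1 Y2 Y3 = coskewness P X1 X2 X3"
    unfolding coskewness_def ext_expectation_def N S ..
  ultimately show ?thesis
    unfolding coskewness_values_def by (metis (mono_tags, lifting) mem_Collect_eq)
qed

definition max_coskewness :: "(real \<Rightarrow> real) \<Rightarrow> (real \<Rightarrow> real) \<Rightarrow> (real \<Rightarrow> real) \<Rightarrow> ereal" where
  "max_coskewness F1 F2 F3 = Sup (coskewness_values F1 F2 F3)"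

definition min_coskewness :: "(real \<Rightarrow> real) \<Rightarrow> (real \<Rightarrow> real) \<Rightarrow> (real \<Rightarrow> real) \<Rightarrow> ereal" where
  "min_coskewness F1 F2 F3 = Inf (coskewness_values F1 F2 F3)"

end

theory Submission
  imports Defs
begin

text \<open>
  After standardization, \<open>\<bar>Z\<^sub>1 Z\<^sub>2 Z\<^sub>3\<bar>\<close> is a product of nonnegative random variables with
  distribution functions \<open>G\<^sub>i\<close>, and its expectation is largest under comonotonicity; this bounds the
  coskewness from both sides by \<open>\<plusminus> E(G\<^sub>1\<^sup>-\<^sup>1(U) G\<^sub>2\<^sup>-\<^sup>1(U) G\<^sub>3\<^sup>-\<^sup>1(U))\<close>. By symmetry,
  the standardization of \<open>F\<^sub>i\<^sup>-\<^sup>1(u)\<close> equals \<open>\<plusminus> G\<^sub>i\<^sup>-\<^sup>1(\<bar>2u - 1\<bar>)\<close> for almost all \<open>u\<close>, with the sign of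
  \<open>u - 1/2\<close>. The proposed \<open>U\<^sub>i\<close> are all \<open>U\<close> or \<open>1 - U\<close>, so the absolute values are comonotone,
  driven by the uniform variable \<open>\<bar>2U - 1\<bar>\<close>, while the fair coins arrange the three signs to have
  product \<open>1\<close> or \<open>-1\<close> without disturbing the marginals.
\<close>

section \<open>The uniform law on the unit interval and its symmetries\<close>

definition std_uniform :: "real measure" where
  "std_uniform = uniform_measure lborel {0..1}"

lemma space_std_uniform [simp]: "space std_uniform = UNIV"
  and sets_std_uniform [simp, measurable_cong]: "sets std_uniform = sets borel"
  by (simp_all add: std_uniform_def)

abbreviation standardize :: "(real \<Rightarrow> real) \<Rightarrow> real \<Rightarrow> real" where
  "standardize F x \<equiv> (x - df_mean F) / df_sd F"

lemma real_distribution_std_uniform: "real_distribution std_uniform"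
proof -
  interpret prob_space std_uniform
    unfolding std_uniform_def by (rule prob_space_uniform_measure) auto
  show ?thesis
    by standard auto
qed

lemma emeasure_std_uniform:
  "A \<in> sets borel \<Longrightarrow> emeasure std_uniform A = emeasure lborel ({0..1} \<inter> A)"
  by (simp add: std_uniform_def divide_ennreal_def)

lemma measure_std_uniform_Icc:
  assumes "A \<in> sets borel" "{0..1} \<inter> A = {a..b}" "a \<le> b"
  shows "measure std_uniform A = b - a"
  unfolding measure_def emeasure_std_uniform[OF assms(1)] assms(2) using assms(3) by simp

lemma cdf_std_uniform:
  assumes "0 \<le> x" "x \<le> 1"
  shows "cdf std_uniform x = x"
proof -
  have "{0..1} \<inter> {..x} = {0..x}"
    using assms by auto
  then show ?thesis
    using assms measure_std_uniform_Icc[of "{..x}" 0 x] by (simp add: cdf_def)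
qed

text \<open>Monotonicity and the bounds 0 and 1 determine a cdf outside the unit interval once its
  values at 0 and 1 are known. Uniformity of the reflected and of the folded variable thus becomes
  the computation of an interval length.\<close>

lemma std_uniform_eqI:
  assumes M: "real_distribution M" and cdf: "\<And>x. 0 \<le> x \<Longrightarrow> x \<le> 1 \<Longrightarrow> cdf M x = x"
  shows "M = std_uniform"
proof -
  have *: "cdf N x = (if x < 0 then 0 else if x > 1 then 1 else x)"
    if N: "real_distribution N" and cdf: "\<And>x. 0 \<le> x \<Longrightarrow> x \<le> 1 \<Longrightarrow> cdf N x = x" for N x
  proof -
    interpret N: real_distribution N by fact
    show ?thesis
      using cdf[of 0] cdf[of 1] cdf[of x] N.cdf_nondecreasing[of x 0] N.cdf_nondecreasing[of 1 x]
        N.cdf_nonneg[of x] N.cdf_bounded_prob[of x] by auto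
  qed
  show ?thesis
    using *[OF M cdf] *[OF real_distribution_std_uniform cdf_std_uniform]
    by (intro cdf_unique M real_distribution_std_uniform) auto
qed

text \<open>\<open>quantile\<close> is meaningful only strictly between 0 and 1, so the endpoints
  are discarded as null. The extra point \<open>c\<close> later removes the centre 1/2, where
  \<open>quantile G\<close> would be taken at 0.\<close>

lemma AE_std_uniform: "AE u in std_uniform. u \<in> {0<..<1} \<and> u \<noteq> c"
proof -
  have "AE u in lborel. u \<in> {0..1} \<longrightarrow> u \<in> {0<..<1} \<and> u \<noteq> c"
    using AE_lborel_singleton[of 0] AE_lborel_singleton[of 1] AE_lborel_singleton[of c]
    by eventually_elim auto
  then show ?thesis
    unfolding std_uniform_def by (intro AE_uniform_measureI) auto
qed

lemma distr_std_uniform_reflect: "distr std_uniform borel (\<lambda>u. 1 - u) = std_uniform"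
proof (rule std_uniform_eqI)
  interpret real_distribution std_uniform by (rule real_distribution_std_uniform)
  show "real_distribution (distr std_uniform borel (\<lambda>u. 1 - u))"
    by (rule real_distribution_distr) auto
  fix x :: real assume "0 \<le> x" "x \<le> 1"
  moreover from this have "{0..1} \<inter> (\<lambda>u. 1 - u) -` {..x} = {1 - x..1}"
    by auto
  ultimately show "cdf (distr std_uniform borel (\<lambda>u. 1 - u)) x = x"
    using measure_std_uniform_Icc[of "(\<lambda>u. 1 - u) -` {..x}" "1 - x" 1]
      measurable_sets[of "\<lambda>u::real. 1 - u" borel borel "{..x}"]
    by (simp add: cdf_def measure_distr)
qed

text \<open>Within the unit interval, the preimage of \<open>{..x}\<close> is the interval of length
  \<open>x\<close> centred at 1/2. This map turns the level of a symmetric law into the level of its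
  absolute standardization.\<close>

lemma distr_std_uniform_fold: "distr std_uniform borel (\<lambda>u. \<bar>2 * u - 1\<bar>) = std_uniform"
proof (rule std_uniform_eqI)
  interpret real_distribution std_uniform by (rule real_distribution_std_uniform)
  show "real_distribution (distr std_uniform borel (\<lambda>u. \<bar>2 * u - 1\<bar>))"
    by (rule real_distribution_distr) auto
  fix x :: real assume "0 \<le> x" "x \<le> 1"
  moreover from this have "{0..1} \<inter> (\<lambda>u. \<bar>2 * u - 1\<bar>) -` {..x} = {(1 - x) / 2..(1 + x) / 2}"
    by (auto simp: abs_le_iff field_simps)
  ultimately show "cdf (distr std_uniform borel (\<lambda>u. \<bar>2 * u - 1\<bar>)) x = x"
    using measure_std_uniform_Icc[of "(\<lambda>u. \<bar>2 * u - 1\<bar>) -` {..x}" "(1 - x) / 2" "(1 + x) / 2"]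
      measurable_sets[of "\<lambda>u::real. \<bar>2 * u - 1\<bar>" borel borel "{..x}"]
    by (simp add: cdf_def measure_distr field_simps)
qed

text \<open>
  The pair \<open>{f U, 1 - f U}\<close> is always \<open>{U, 1 - U}\<close>, so choosing one of its two elements by an
  independent fair coin gives the same law whatever \<open>f\<close> is.
\<close>

lemma distr_coin_reflect:
  fixes U V :: "'a \<Rightarrow> real"
  assumes "prob_space P"
    and U [measurable]: "U \<in> borel_measurable P" and dU: "distr P borel U = std_uniform"
    and V [measurable]: "V \<in> borel_measurable P" and dV: "distr P borel V = std_uniform"
    and UV: "prob_space.indep_var P borel U borel V"
    and f [measurable]: "f \<in> borel_measurable borel" and ff: "\<And>u. f u = u \<or> f u = 1 - u"
  shows "distr P borel (\<lambda>\<omega>. if V \<omega> > 1/2 then f (U \<omega>) else 1 - f (U \<omega>)) = std_uniform"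
proof -
  interpret prob_space P by fact
  interpret S: real_distribution std_uniform by (rule real_distribution_std_uniform)
  let ?X = "\<lambda>\<omega>. if V \<omega> > 1/2 then f (U \<omega>) else 1 - f (U \<omega>)"
  have half: "prob (V -` {1/2<..} \<inter> space P) = 1/2" "prob (V -` {..1/2} \<inter> space P) = 1/2"
  proof -
    have "prob (V -` {..1/2} \<inter> space P) = cdf (distr P borel V) (1/2)"
      by (simp add: cdf_def measure_distr)
    then show *: "prob (V -` {..1/2} \<inter> space P) = 1/2"
      by (simp add: dV cdf_std_uniform)
    have "V -` {1/2<..} \<inter> space P = space P - V -` {..1/2} \<inter> space P"
      by auto
    then show "prob (V -` {1/2<..} \<inter> space P) = 1/2"
      using prob_compl[of "V -` {..1/2} \<inter> space P"] * by simp
  qed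
  have indep: "prob ((\<lambda>\<omega>. (U \<omega>, V \<omega>)) -` (B \<times> C) \<inter> space P) =
      measure std_uniform B * prob (V -` C \<inter> space P)"
    if "B \<in> sets borel" "C \<in> sets borel" for B C
    using indep_varD[OF UV that] that by (simp add: dU[symmetric] measure_distr)
  have "cdf (distr P borel ?X) x = cdf std_uniform x" for x
  proof -
    define A where "A = {..x}"
    have A: "f -` A \<in> sets borel" "(\<lambda>u. 1 - f u) -` A \<in> sets borel" "(\<lambda>u. 1 - u) -` A \<in> sets borel"
      using measurable_sets[OF f, of A] measurable_sets[of "\<lambda>u. 1 - f u" borel borel A]
        measurable_sets[of "\<lambda>u::real. 1 - u" borel borel A] by (auto simp: A_def)
    have UVm: "(\<lambda>\<omega>. (U \<omega>, V \<omega>)) -` (B \<times> C) \<inter> space P \<in> events"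
      if "B \<in> sets borel" "C \<in> sets borel" for B C
      using that by (intro measurable_sets[where A="borel \<Otimes>\<^sub>M borel"]) auto
    have "cdf (distr P borel ?X) x = prob (?X -` A \<inter> space P)"
      by (simp add: cdf_def measure_distr A_def)
    also have "?X -` A \<inter> space P = ((\<lambda>\<omega>. (U \<omega>, V \<omega>)) -` ((f -` A) \<times> {1/2<..}) \<inter> space P) \<union>
        ((\<lambda>\<omega>. (U \<omega>, V \<omega>)) -` (((\<lambda>u. 1 - f u) -` A) \<times> {..1/2}) \<inter> space P)"
      by (auto split: if_splits)
    also have "prob \<dots> = prob ((\<lambda>\<omega>. (U \<omega>, V \<omega>)) -` ((f -` A) \<times> {1/2<..}) \<inter> space P) +
        prob ((\<lambda>\<omega>. (U \<omega>, V \<omega>)) -` (((\<lambda>u. 1 - f u) -` A) \<times> {..1/2}) \<inter> space P)"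
      by (intro finite_measure_Union UVm A) auto
    also have "\<dots> = (measure std_uniform (f -` A) + measure std_uniform ((\<lambda>u. 1 - f u) -` A)) / 2"
      using A by (simp add: indep half add_divide_distrib)
    \<comment> \<open>Each of the two measures may depend on \<open>f\<close>. Under one integral,
      the indicators count how many of \<open>f u\<close> and \<open>1 - f u\<close> lie in
      \<open>A\<close>, and these two points are \<open>u\<close> and \<open>1 - u\<close> in some
      order.\<close>
    also have "measure std_uniform (f -` A) + measure std_uniform ((\<lambda>u. 1 - f u) -` A) =
        (LINT u|std_uniform. indicator (f -` A) u + indicator ((\<lambda>u. 1 - f u) -` A) u)"
      using A by (simp add: S.emeasure_eq_measure)
    also have "\<dots> = (LINT u|std_uniform. indicator A u + indicator ((\<lambda>u. 1 - u) -` A) u)"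
    proof (rule Bochner_Integration.integral_cong)
      show "(indicator (f -` A) u :: real) + indicator ((\<lambda>u. 1 - f u) -` A) u =
          indicator A u + indicator ((\<lambda>u. 1 - u) -` A) u" for u
        using ff[of u] by (auto simp: indicator_def)
    qed simp
    also have "\<dots> = measure std_uniform A + measure std_uniform ((\<lambda>u. 1 - u) -` A)"
      using A by (simp add: S.emeasure_eq_measure A_def)
    also have "measure std_uniform ((\<lambda>u. 1 - u) -` A) = measure std_uniform A"
      using arg_cong[OF distr_std_uniform_reflect, of "\<lambda>M. measure M A"]
      by (subst (asm) measure_distr) (auto simp: A_def)
    finally show ?thesis
      by (simp add: cdf_def A_def)
  qed
  then show ?thesis
    by (intro cdf_unique real_distribution_distr real_distribution_std_uniform) auto
qed

section \<open>Distribution functions and their quantile functions\<close>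

lemma distribution_functionD:
  assumes "distribution_function F"
  shows real_distribution_df: "real_distribution (interval_measure F)"
    and cdf_df: "cdf (interval_measure F) = F"
  using assms unfolding distribution_function_def
  by (auto intro!: real_distribution_interval_measure cdf_interval_measure simp: mono_def)

lemma distribution_function_cdf:
  assumes "real_distribution M"
  shows "distribution_function (cdf M)"
proof -
  interpret real_distribution M by fact
  show ?thesis
    unfolding distribution_function_def
    by (simp add: mono_def cdf_nondecreasing cdf_is_right_cont cdf_lim_at_bot cdf_lim_at_top_prob)
qed

text \<open>A Galois connection: right continuity of \<open>F\<close> makes the defining infimum
  attained. Later comparisons of quantiles go through this equivalence.\<close>

lemma quantile_le_iff:
  assumes F: "distribution_function F" and u: "0 < u" "u < 1"
  shows "quantile F u \<le> x \<longleftrightarrow> u \<le> F x"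
proof -
  interpret cdf_distribution "interval_measure F"
    by (simp add: cdf_distribution_def real_distribution_df[OF F])
  show ?thesis
    using pseudoinverse[OF u, of x] by (simp add: cdf_df[OF F] quantile_def)
qed

text \<open>The function is monotone on the open unit interval. For \<open>u \<le> 0\<close> and
  \<open>u > 1\<close> the defining set is \<open>UNIV\<close> or empty, so the value is an
  unspecified constant, hence also monotone. The level 1 forms a piece of its own, since there
  emptiness of the set depends on \<open>F\<close>.\<close>

lemma measurable_quantile [measurable]:
  assumes F: "distribution_function F"
  shows "quantile F \<in> borel_measurable borel"
proof -
  interpret cdf_distribution "interval_measure F"
    by (simp add: cdf_distribution_def real_distribution_df[OF F])
  have b: "0 \<le> F x" "F x \<le> 1" for x
    using cdf_nonneg[of x] cdf_bounded_prob[of x] by (simp_all add: cdf_df[OF F])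
  have "quantile F u = Inf UNIV" if "u \<le> 0" for u
  proof -
    have "u \<le> F x" for x
      using b(1)[of x] that by simp
    then show ?thesis
      by (simp add: quantile_def)
  qed
  then have "mono_on {..0} (quantile F)"
    by (auto intro!: mono_onI)
  moreover have "quantile F u = Inf {}" if "u > 1" for u
  proof -
    have "\<not> u \<le> F x" for x
      using b(2)[of x] that by auto
    then show ?thesis
      by (simp add: quantile_def)
  qed
  then have "mono_on {1<..} (quantile F)"
    by (auto intro!: mono_onI)
  moreover have "mono_on {0<..<1} (quantile F)"
    using mono_I by (simp add: cdf_df[OF F] quantile_def[abs_def])
  moreover have "mono_on {1} (quantile F)"
    by (auto intro!: mono_onI)
  moreover have "\<Union>{{..0}, {0<..<1}, {1}, {1<..}} = (UNIV :: real set)"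
    by auto
  ultimately show ?thesis
    by (intro borel_measurable_piecewise_mono[of "{{..0}, {0<..<1}, {1}, {1<..}}"]) auto
qed

text \<open>The quantile transform: at interior levels \<open>quantile F u \<le> x\<close> is the
  event \<open>u \<le> F x\<close>, which has uniform measure \<open>F x\<close>; all other levels
  are null.\<close>

lemma distr_quantile:
  assumes F: "distribution_function F"
  shows "distr std_uniform borel (quantile F) = interval_measure F"
proof -
  interpret real_distribution std_uniform by (rule real_distribution_std_uniform)
  interpret F: real_distribution "interval_measure F" by (rule real_distribution_df[OF F])
  note [measurable] = measurable_quantile[OF F]
  show ?thesis
  proof (rule cdf_unique[OF real_distribution_distr real_distribution_df[OF F]])
    show "cdf (distr std_uniform borel (quantile F)) = cdf (interval_measure F)"
    proof
      fix x
      have "cdf (distr std_uniform borel (quantile F)) x = measure std_uniform (quantile F -` {..x})"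
        by (simp add: cdf_def measure_distr)
      also have "\<dots> = measure std_uniform {..F x}"
      proof (rule measure_eq_AE)
        show "AE u in std_uniform. (u \<in> quantile F -` {..x}) = (u \<in> {..F x})"
          using AE_std_uniform[of 0] by eventually_elim (auto simp: quantile_le_iff[OF F])
      qed (use measurable_sets[OF measurable_quantile[OF F], of "{..x}"] in auto)
      also have "\<dots> = F x"
        using F.cdf_nonneg[of x] F.cdf_bounded_prob[of x] cdf_std_uniform[of "F x"]
        unfolding cdf_df[OF F] by (simp add: cdf_def)
      finally show "cdf (distr std_uniform borel (quantile F)) x = cdf (interval_measure F) x"
        by (simp add: cdf_df[OF F])
    qed
  qed auto
qed

section \<open>The comonotone bound for the expected product of three variables\<close>

text \<open>The integrand is the volume of the box with sides \<open>{0<..<f \<omega>}\<close>,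
  \<open>{0<..<g \<omega>}\<close> and \<open>{0<..<h \<omega>}\<close>. Tonelli measures the region
  \<open>N\<close> formed by these boxes in the other order. A negative factor gives an empty side,
  matching the truncation by \<open>ennreal\<close>.\<close>

lemma nn_integral_prod3_layer_cake:
  fixes f g h :: "'a \<Rightarrow> real"
  assumes "prob_space P"
    and [measurable]: "f \<in> borel_measurable P" "g \<in> borel_measurable P" "h \<in> borel_measurable P"
  shows "(\<integral>\<^sup>+\<omega>. ennreal (f \<omega>) * (ennreal (g \<omega>) * ennreal (h \<omega>)) \<partial>P) =
    (\<integral>\<^sup>+(a, b, c). emeasure P {\<omega>\<in>space P. (0 < a \<and> a < f \<omega>) \<and> (0 < b \<and> b < g \<omega>) \<and> (0 < c \<and> c < h \<omega>)}
      \<partial>(lborel \<Otimes>\<^sub>M (lborel \<Otimes>\<^sub>M lborel)))"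
proof -
  interpret prob_space P by fact
  have L2: "sigma_finite_measure (lborel \<Otimes>\<^sub>M lborel :: (real \<times> real) measure)"
    by (intro sigma_finite_pair_measure lborel.sigma_finite_measure_axioms)
  interpret L3': sigma_finite_measure "lborel \<Otimes>\<^sub>M (lborel \<Otimes>\<^sub>M lborel) :: (real \<times> real \<times> real) measure"
    by (intro sigma_finite_pair_measure L2 lborel.sigma_finite_measure_axioms)
  interpret PL: pair_sigma_finite P "lborel \<Otimes>\<^sub>M (lborel \<Otimes>\<^sub>M lborel) :: (real \<times> real \<times> real) measure" ..
  let ?L = "lborel \<Otimes>\<^sub>M (lborel \<Otimes>\<^sub>M lborel) :: (real \<times> real \<times> real) measure"
  define N where "N = {p \<in> space (P \<Otimes>\<^sub>M ?L). (0 < fst (snd p) \<and> fst (snd p) < f (fst p)) \<and>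
    (0 < fst (snd (snd p)) \<and> fst (snd (snd p)) < g (fst p)) \<and>
    (0 < snd (snd (snd p)) \<and> snd (snd (snd p)) < h (fst p))}"
  have N: "N \<in> sets (P \<Otimes>\<^sub>M ?L)"
    unfolding N_def by measurable
  have Ioo: "emeasure lborel {0<..<x} = ennreal x" for x :: real
    by (cases "0 \<le> x") (auto simp: ennreal_neg)
  have "ennreal (f \<omega>) * (ennreal (g \<omega>) * ennreal (h \<omega>)) = emeasure ?L (Pair \<omega> -` N)"
    if "\<omega> \<in> space P" for \<omega>
  proof -
    have "Pair \<omega> -` N = {0<..<f \<omega>} \<times> ({0<..<g \<omega>} \<times> {0<..<h \<omega>})"
      using that by (auto simp: N_def space_pair_measure)
    then show ?thesis
      by (simp add: sigma_finite_measure.emeasure_pair_measure_Times[OF L2] lborel.emeasure_pair_measure_Times Ioo)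
  qed
  then have "(\<integral>\<^sup>+\<omega>. ennreal (f \<omega>) * (ennreal (g \<omega>) * ennreal (h \<omega>)) \<partial>P) = emeasure (P \<Otimes>\<^sub>M ?L) N"
    using N by (simp add: L3'.emeasure_pair_measure_alt cong: nn_integral_cong)
  also have "\<dots> = (\<integral>\<^sup>+p. emeasure P ((\<lambda>\<omega>. (\<omega>, p)) -` N) \<partial>?L)"
    using N by (rule PL.emeasure_pair_measure_alt2)
  also have "\<dots> = (\<integral>\<^sup>+(a, b, c). emeasure P {\<omega>\<in>space P. (0 < a \<and> a < f \<omega>) \<and> (0 < b \<and> b < g \<omega>) \<and> (0 < c \<and> c < h \<omega>)} \<partial>?L)"
    by (intro nn_integral_cong)
      (auto simp: N_def space_pair_measure split: prod.split intro!: arg_cong[where f="emeasure P"])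
  finally show ?thesis .
qed

text \<open>At interior \<open>u\<close> the tail event \<open>a < quantile F u\<close> is
  \<open>F a < u\<close>, so tail events are nested by their levels, a higher level giving a smaller
  event.\<close>

lemma AE_quantile_tail_mono:
  assumes "distribution_function F" "distribution_function G" "G b \<le> F a"
  shows "AE u in std_uniform. a < quantile F u \<longrightarrow> b < quantile G u"
  using AE_std_uniform[of 0]
proof eventually_elim
  case (elim u)
  then show ?case
    using quantile_le_iff[OF assms(1), of u a] quantile_le_iff[OF assms(2), of u b] assms(3) by auto
qed

lemma emeasure_quantile_tail:
  assumes Q: "prob_space Q" and [measurable]: "Y \<in> borel_measurable Q"
    and G: "cdf (distr Q borel Y) = G"
  shows "emeasure Q {\<omega>\<in>space Q. a < Y \<omega>} = emeasure std_uniform {u. a < quantile G u}"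
proof -
  interpret prob_space Q by fact
  have df: "distribution_function G"
    unfolding G[symmetric] by (intro distribution_function_cdf real_distribution_distr) simp
  note [measurable] = measurable_quantile[OF df]
  have "distr Q borel Y = distr std_uniform borel (quantile G)"
    unfolding distr_quantile[OF df]
    by (intro cdf_unique real_distribution_df[OF df]) (simp_all add: G cdf_df[OF df])
  then have "emeasure (distr Q borel Y) {a<..} = emeasure (distr std_uniform borel (quantile G)) {a<..}"
    by simp
  then show ?thesis
    by (simp add: emeasure_distr vimage_def Int_def conj_commute)
qed

text \<open>
  By the layer-cake formula it suffices to compare joint tail probabilities. The tail events of
  the quantile functions form a chain, so the probability of their intersection is the smallest
  of the three, which is an upper bound under any dependence.
\<close>

lemma nn_integral_prod3_le_quantile:
  fixes Y1 Y2 Y3 :: "'a \<Rightarrow> real"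
  assumes Q: "prob_space Q"
    and Y [measurable]: "Y1 \<in> borel_measurable Q" "Y2 \<in> borel_measurable Q" "Y3 \<in> borel_measurable Q"
    and G: "cdf (distr Q borel Y1) = G1" "cdf (distr Q borel Y2) = G2" "cdf (distr Q borel Y3) = G3"
  shows "(\<integral>\<^sup>+\<omega>. ennreal (Y1 \<omega>) * (ennreal (Y2 \<omega>) * ennreal (Y3 \<omega>)) \<partial>Q) \<le>
    (\<integral>\<^sup>+u. ennreal (quantile G1 u) * (ennreal (quantile G2 u) * ennreal (quantile G3 u)) \<partial>std_uniform)"
proof -
  interpret prob_space Q by fact
  interpret S: real_distribution std_uniform by (rule real_distribution_std_uniform)
  have df: "distribution_function G1" "distribution_function G2" "distribution_function G3"
    unfolding G[symmetric] by (intro distribution_function_cdf real_distribution_distr; simp)+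
  note [measurable] = df[THEN measurable_quantile]
  have le: "emeasure Q {\<omega>\<in>space Q. a < Y1 \<omega> \<and> b < Y2 \<omega> \<and> c < Y3 \<omega>} \<le>
      emeasure std_uniform {u. a < quantile G1 u \<and> b < quantile G2 u \<and> c < quantile G3 u}"
    (is "?l \<le> ?r") for a b c
  proof -
    note q = AE_quantile_tail_mono[OF df(1) df(2)] AE_quantile_tail_mono[OF df(1) df(3)]
      AE_quantile_tail_mono[OF df(2) df(1)] AE_quantile_tail_mono[OF df(2) df(3)]
      AE_quantile_tail_mono[OF df(3) df(1)] AE_quantile_tail_mono[OF df(3) df(2)]
    \<comment> \<open>Each case names a largest level among \<open>G1 a\<close>, \<open>G2 b\<close>
      and \<open>G3 c\<close>. The tail event at that level lies almost surely in the other two, so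
      its probability is at most \<open>?r\<close>.\<close>
    consider "G2 b \<le> G1 a" "G3 c \<le> G1 a" | "G1 a \<le> G2 b" "G3 c \<le> G2 b" | "G1 a \<le> G3 c" "G2 b \<le> G3 c"
      by linarith
    then show ?thesis
    proof cases
      case 1
      have "?l \<le> emeasure Q {\<omega>\<in>space Q. a < Y1 \<omega>}"
        by (rule emeasure_mono) auto
      also have "\<dots> = emeasure std_uniform {u. a < quantile G1 u}"
        by (rule emeasure_quantile_tail[OF Q Y(1) G(1)])
      also have "\<dots> \<le> ?r"
        using q(1)[OF 1(1)] q(2)[OF 1(2)] by (intro emeasure_mono_AE) auto
      finally show ?thesis .
    next
      case 2
      have "?l \<le> emeasure Q {\<omega>\<in>space Q. b < Y2 \<omega>}"
        by (rule emeasure_mono) auto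
      also have "\<dots> = emeasure std_uniform {u. b < quantile G2 u}"
        by (rule emeasure_quantile_tail[OF Q Y(2) G(2)])
      also have "\<dots> \<le> ?r"
        using q(3)[OF 2(1)] q(4)[OF 2(2)] by (intro emeasure_mono_AE) auto
      finally show ?thesis .
    next
      case 3
      have "?l \<le> emeasure Q {\<omega>\<in>space Q. c < Y3 \<omega>}"
        by (rule emeasure_mono) auto
      also have "\<dots> = emeasure std_uniform {u. c < quantile G3 u}"
        by (rule emeasure_quantile_tail[OF Q Y(3) G(3)])
      also have "\<dots> \<le> ?r"
        using q(5)[OF 3(1)] q(6)[OF 3(2)] by (intro emeasure_mono_AE) auto
      finally show ?thesis .
    qed
  qed
  \<comment> \<open>The positivity conditions concern only \<open>a\<close>, \<open>b\<close>,
    \<open>c\<close>; if one of them fails, both events are empty.\<close>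
  have "emeasure Q {\<omega>\<in>space Q. (0 < a \<and> a < Y1 \<omega>) \<and> (0 < b \<and> b < Y2 \<omega>) \<and> (0 < c \<and> c < Y3 \<omega>)} \<le>
      emeasure std_uniform {u\<in>space std_uniform. (0 < a \<and> a < quantile G1 u) \<and>
        (0 < b \<and> b < quantile G2 u) \<and> (0 < c \<and> c < quantile G3 u)}" for a b c
    using le[of a b c] by (cases "0 < a \<and> 0 < b \<and> 0 < c") auto
  then show ?thesis
    unfolding nn_integral_prod3_layer_cake[OF Q Y]
    by (subst nn_integral_prod3_layer_cake[OF S.prob_space_axioms])
      (auto intro!: nn_integral_mono split: prod.split)
qed

section \<open>Quantiles of a symmetric law and of its absolute standardization\<close>

locale symmetric_law =
  fixes F :: "real \<Rightarrow> real"
  assumes df: "distribution_function F" and si: "square_integrable_df F"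
    and sd_pos: "df_sd F > 0" and sym: "symmetric_df F"
begin

abbreviation "m \<equiv> df_mean F"
abbreviation "s \<equiv> df_sd F"
abbreviation "M \<equiv> interval_measure F"
abbreviation "G \<equiv> abs_standardized_df F"

sublocale real_distribution M
  by (rule real_distribution_df[OF df])

lemmas measurable_q [measurable] = measurable_quantile[OF df]

lemma df_G: "distribution_function G"
  unfolding abs_standardized_df_def
  by (intro distribution_function_cdf real_distribution_distr) simp

lemmas measurable_qG [measurable] = measurable_quantile[OF df_G]

lemma F_eq: "F x = measure M {..x}"
  using fun_cong[OF cdf_df[OF df], of x] by (simp add: cdf_def)

lemma prob_ge_reflect: "prob {m - t..} = F (m + t)"
proof -
  have "measure (distr M borel (\<lambda>x. x - m)) {..t} = measure (distr M borel (\<lambda>x. m - x)) {..t}"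
    using sym by (simp add: symmetric_df_def)
  moreover have "(\<lambda>x. x - m) -` {..t} = {..m + t}" "(\<lambda>x. m - x) -` {..t} = {m - t..}"
    by auto
  ultimately show ?thesis
    by (simp add: measure_distr F_eq)
qed

lemma prob_less_reflect: "prob {..<m - t} = 1 - F (m + t)"
proof -
  have "{..<m - t} = space M - {m - t..}"
    by auto
  then show ?thesis
    using prob_compl[of "{m - t..}"] prob_ge_reflect[of t] by simp
qed

text \<open>The half-lines \<open>{..m + t}\<close> and \<open>{m - t..}\<close> are disjoint for
  negative \<open>t\<close> and have equal mass by symmetry.\<close>

lemma F_less_mean: "t < 0 \<Longrightarrow> F (m + t) \<le> 1/2"
proof -
  assume "t < 0"
  then have "prob {..m + t} + prob {m - t..} = prob ({..m + t} \<union> {m - t..})"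
    by (intro finite_measure_Union[symmetric]) auto
  also have "\<dots> \<le> 1"
    by (rule prob_le_1)
  finally show ?thesis
    by (simp add: prob_ge_reflect F_eq)
qed

text \<open>For nonnegative \<open>x\<close> the event is the closed interval of radius
  \<open>s * x\<close> around the mean. It arises from \<open>{..m + s * x}\<close> by removing the
  open left tail, whose mass is \<open>1 - F (m + s * x)\<close>; the open tail keeps the formula
  exact in the presence of atoms.\<close>

lemma G_eq: "G x = (if x < 0 then 0 else 2 * F (m + s * x) - 1)"
proof -
  have "G x = prob ((\<lambda>x. \<bar>standardize F x\<bar>) -` {..x})"
    by (simp add: abs_standardized_df_def cdf_def measure_distr)
  also have "(\<lambda>x. \<bar>standardize F x\<bar>) -` {..x} = {m - s * x..m + s * x}"
    using sd_pos by (auto simp: abs_le_iff field_simps)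
  also have "prob \<dots> = (if x < 0 then 0 else 2 * F (m + s * x) - 1)"
  proof (cases "x < 0")
    case True
    then have "s * x < 0"
      using sd_pos by (simp add: mult_pos_neg)
    with True show ?thesis by simp
  next
    case False
    then have "0 \<le> s * x"
      using sd_pos by simp
    then have "{m - s * x..m + s * x} = {..m + s * x} - {..<m - s * x}" "{..<m - s * x} \<subseteq> {..m + s * x}"
      by auto
    with False show ?thesis
      using finite_measure_Diff[of "{..m + s * x}" "{..<m - s * x}"]
      by (simp add: prob_less_reflect F_eq)
  qed
  finally show ?thesis .
qed

lemma quantile_G_nonneg:
  assumes "0 < u" "u < 1"
  shows "0 \<le> quantile G u"
proof (rule dense_le)
  fix x :: real assume "x < 0"
  then have "\<not> u \<le> G x"
    using assms by (simp add: G_eq)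
  then show "x \<le> quantile G u"
    using quantile_le_iff[OF df_G assms, of x] by simp
qed

lemma quantile_upper_half:
  assumes "1/2 < u" "u < 1"
  shows "standardize F (quantile F u) = quantile G (2 * u - 1)"
proof -
  have "quantile G (2 * u - 1) \<le> x \<longleftrightarrow> standardize F (quantile F u) \<le> x" for x
  proof -
    have "quantile G (2 * u - 1) \<le> x \<longleftrightarrow> 2 * u - 1 \<le> G x"
      using assms by (intro quantile_le_iff df_G) auto
    \<comment> \<open>For negative \<open>x\<close> both sides are false: \<open>G x\<close> is 0
      while \<open>2 * u - 1\<close> is positive, and \<open>F (m + s * x)\<close> is at most
      1/2.\<close>
    also have "\<dots> \<longleftrightarrow> u \<le> F (m + s * x)"
      using F_less_mean[of "s * x"] sd_pos assms by (auto simp: G_eq mult_pos_neg)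
    also have "\<dots> \<longleftrightarrow> quantile F u \<le> m + s * x"
      using assms by (intro quantile_le_iff[symmetric] df) auto
    also have "\<dots> \<longleftrightarrow> standardize F (quantile F u) \<le> x"
      using sd_pos by (simp add: field_simps)
    finally show ?thesis .
  qed
  then show ?thesis
    by (meson order_antisym order_refl)
qed

text \<open>If \<open>y\<close> lies below \<open>quantile F u\<close>, then \<open>F y < u\<close>.
  Symmetry then gives \<open>F (2 * m - y) \<ge> 1 - F y\<close>, so \<open>2 * m - y\<close> bounds
  the quantile at \<open>1 - u\<close> from above. Letting \<open>y\<close> approach
  \<open>quantile F u\<close> gives the claim.\<close>

lemma quantile_reflect_le:
  assumes "0 < u" "u < 1"
  shows "quantile F u + quantile F (1 - u) \<le> 2 * m"
proof -
  have "quantile F u \<le> 2 * m - quantile F (1 - u)"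
  proof (rule dense_le)
    fix y assume "y < quantile F u"
    then have "F y < u"
      using quantile_le_iff[OF df assms, of y] by simp
    moreover have "F (m + (m - y)) = 1 - prob {..<y}"
      using prob_less_reflect[of "m - y"] by simp
    moreover have "prob {..<y} \<le> F y"
      unfolding F_eq[of y] by (rule finite_measure_mono) auto
    ultimately have "1 - u \<le> F (2 * m - y)"
      by (simp add: algebra_simps)
    then show "y \<le> 2 * m - quantile F (1 - u)"
      using quantile_le_iff[OF df, of "1 - u" "2 * m - y"] assms by simp
  qed
  then show ?thesis by simp
qed

lemma integrable_id: "integrable M (\<lambda>x. x)"
proof (rule square_integrable_imp_integrable)
  show "integrable M (\<lambda>x. x\<^sup>2)"
    using si by (simp add: square_integrable_df_def)
qed simp

text \<open>
  The two sides differ by a sign-definite function whose integral vanishes; pointwise the equality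
  can fail at the jumps of the quantile function.
\<close>

lemma AE_quantile_reflect:
  "AE u in std_uniform. quantile F u + quantile F (1 - u) = 2 * m"
proof -
  interpret S: real_distribution std_uniform by (rule real_distribution_std_uniform)
  let ?d = "\<lambda>u. 2 * m - quantile F u - quantile F (1 - u)"
  have r: "integrable std_uniform f \<longleftrightarrow> integrable std_uniform (\<lambda>u. f (1 - u))"
    "(LINT u|std_uniform. f u) = (LINT u|std_uniform. f (1 - u))"
    if "f \<in> borel_measurable borel" for f :: "real \<Rightarrow> real"
  proof -
    have m: "(\<lambda>u. 1 - u) \<in> std_uniform \<rightarrow>\<^sub>M borel"
      by measurable
    show "integrable std_uniform f \<longleftrightarrow> integrable std_uniform (\<lambda>u. f (1 - u))"
      using integrable_distr_eq[OF m that] unfolding distr_std_uniform_reflect .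
    show "(LINT u|std_uniform. f u) = (LINT u|std_uniform. f (1 - u))"
      using integral_distr[OF m that] unfolding distr_std_uniform_reflect .
  qed
  have q: "quantile F \<in> std_uniform \<rightarrow>\<^sub>M borel"
    by measurable
  have "integrable (distr std_uniform borel (quantile F)) (\<lambda>x. x)"
    unfolding distr_quantile[OF df] by (rule integrable_id)
  then have i: "integrable std_uniform (quantile F)"
    by (rule integrable_distr[OF q])
  have e: "(LINT u|std_uniform. quantile F u) = m"
    unfolding df_mean_def distr_quantile[OF df, symmetric] by (rule integral_distr[OF q, symmetric]) simp
  \<comment> \<open>Reflection preserves the uniform law, so the reflected quantile function also
    has mean \<open>m\<close>, and \<open>?d\<close> integrates to
    \<open>2 * m - m - m\<close>.\<close>
  have i': "integrable std_uniform (\<lambda>u. quantile F (1 - u))" "(LINT u|std_uniform. quantile F (1 - u)) = m"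
    using i e unfolding r[OF measurable_q] .
  have "AE u in std_uniform. 0 \<le> ?d u"
    using AE_std_uniform[of 0] by eventually_elim (use quantile_reflect_le in force)
  moreover have "integrable std_uniform ?d" "(LINT u|std_uniform. ?d u) = 0"
    using i i' e S.prob_space by simp_all
  ultimately have "AE u in std_uniform. ?d u = 0"
    using integral_nonneg_eq_0_iff_AE by blast
  then show ?thesis
    by eventually_elim simp
qed

text \<open>Above 1/2 this is \<open>quantile_upper_half\<close>; below 1/2 the same fact applies to
  \<open>1 - u\<close>, and reflection through the mean changes the sign. Both \<open>u\<close> and
  \<open>1 - u\<close> are recorded because every coupling variable equals \<open>U\<close> or
  \<open>1 - U\<close>.\<close>

lemma AE_standardize_quantile:
  "AE u in std_uniform. standardize F (quantile F u) = (if u > 1/2 then 1 else -1) * quantile G \<bar>2 * u - 1\<bar> \<and>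
    standardize F (quantile F (1 - u)) = (if u > 1/2 then -1 else 1) * quantile G \<bar>2 * u - 1\<bar>"
  using AE_std_uniform[of "1/2"] AE_quantile_reflect
proof eventually_elim
  case (elim u)
  have *: "standardize F (quantile F (1 - u)) = - standardize F (quantile F u)"
    using elim(2) by (simp add: minus_divide_left eq_diff_eq)
  show ?case
  proof (cases "u > 1/2")
    case True
    then show ?thesis
      using * quantile_upper_half[of u] elim(1) by simp
  next
    case False
    then show ?thesis
      using * quantile_upper_half[of "1 - u"] elim(1) by (simp add: abs_if)
  qed
qed

lemma has_distributionD:
  assumes "prob_space P" "has_distribution P X F"
  shows "X \<in> borel_measurable P" "distr P borel X = M"
    "prob_space.expectation P X = m" "std_dev P X = s"
    "cdf (distr P borel (\<lambda>\<omega>. \<bar>standardize F (X \<omega>)\<bar>)) = G"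
proof -
  interpret P: prob_space P by fact
  show X [measurable]: "X \<in> borel_measurable P"
    using assms(2) by (simp add: has_distribution_def)
  show d: "distr P borel X = M"
    using assms(2) by (intro cdf_unique P.real_distribution_distr real_distribution_df[OF df])
      (simp_all add: has_distribution_def cdf_df[OF df])
  show e: "prob_space.expectation P X = m"
    unfolding df_mean_def d[symmetric] by (simp add: integral_distr)
  show "std_dev P X = s"
    unfolding std_dev_def df_sd_def e unfolding d[symmetric] by (simp add: integral_distr)
  show "cdf (distr P borel (\<lambda>\<omega>. \<bar>standardize F (X \<omega>)\<bar>)) = G"
    unfolding abs_standardized_df_def unfolding d[symmetric] by (simp add: distr_distr comp_def)
qed

lemma has_distribution_quantile:
  assumes [measurable]: "W \<in> borel_measurable P" and W: "distr P borel W = std_uniform"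
  shows "has_distribution P (\<lambda>\<omega>. quantile F (W \<omega>)) F"
proof -
  have "distr P borel (\<lambda>\<omega>. quantile F (W \<omega>)) = M"
    unfolding distr_quantile[OF df, symmetric] W[symmetric] by (simp add: distr_distr comp_def)
  then show ?thesis
    by (simp add: has_distribution_def cdf_df[OF df])
qed

end

section \<open>Expectations with values in the extended reals\<close>

lemma expectation_well_defined_AE:
  assumes [measurable]: "f \<in> borel_measurable P"
    and "(AE \<omega> in P. 0 \<le> f \<omega>) \<or> (AE \<omega> in P. f \<omega> \<le> 0)"
  shows "expectation_well_defined P f"
  using assms(2)
proof
  assume "AE \<omega> in P. 0 \<le> f \<omega>"
  then have "(\<integral>\<^sup>+\<omega>. ennreal (- f \<omega>) \<partial>P) = 0"
    by (subst nn_integral_0_iff_AE) (auto simp: ennreal_eq_0_iff)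
  then show ?thesis
    by (simp add: expectation_well_defined_def)
next
  assume "AE \<omega> in P. f \<omega> \<le> 0"
  then have "(\<integral>\<^sup>+\<omega>. ennreal (f \<omega>) \<partial>P) = 0"
    by (subst nn_integral_0_iff_AE) (auto simp: ennreal_eq_0_iff)
  then show ?thesis
    by (simp add: expectation_well_defined_def)
qed

lemma ext_expectation_nonneg:
  assumes [measurable]: "f \<in> borel_measurable P" and "AE \<omega> in P. 0 \<le> f \<omega>"
  shows "ext_expectation P f = enn2ereal (\<integral>\<^sup>+\<omega>. ennreal (f \<omega>) \<partial>P)"
    and "ext_expectation P (\<lambda>\<omega>. - f \<omega>) = - enn2ereal (\<integral>\<^sup>+\<omega>. ennreal (f \<omega>) \<partial>P)"
proof -
  have "(\<integral>\<^sup>+\<omega>. ennreal (- f \<omega>) \<partial>P) = 0"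
    using assms(2) by (subst nn_integral_0_iff_AE) (auto simp: ennreal_eq_0_iff)
  then show "ext_expectation P f = enn2ereal (\<integral>\<^sup>+\<omega>. ennreal (f \<omega>) \<partial>P)"
    and "ext_expectation P (\<lambda>\<omega>. - f \<omega>) = - enn2ereal (\<integral>\<^sup>+\<omega>. ennreal (f \<omega>) \<partial>P)"
    by (simp_all add: ext_expectation_def zero_ennreal.rep_eq)
qed

lemma ext_expectation_cong_AE:
  assumes "AE \<omega> in P. f \<omega> = g \<omega>"
  shows "ext_expectation P f = ext_expectation P g"
proof -
  have "(\<integral>\<^sup>+\<omega>. ennreal (f \<omega>) \<partial>P) = (\<integral>\<^sup>+\<omega>. ennreal (g \<omega>) \<partial>P)"
    "(\<integral>\<^sup>+\<omega>. ennreal (- f \<omega>) \<partial>P) = (\<integral>\<^sup>+\<omega>. ennreal (- g \<omega>) \<partial>P)"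
    using assms by (auto intro!: nn_integral_cong_AE)
  then show ?thesis
    by (simp add: ext_expectation_def)
qed

text \<open>The positive and the negative part are both dominated by the absolute value, so for
  finite \<open>K\<close> the expectation is a difference of two elements of \<open>[0, K]\<close>.
  For infinite \<open>K\<close> the bounds are trivial.\<close>

lemma ext_expectation_bounds:
  assumes "(\<integral>\<^sup>+\<omega>. ennreal \<bar>f \<omega>\<bar> \<partial>P) \<le> K"
  shows "ext_expectation P f \<le> enn2ereal K" "- enn2ereal K \<le> ext_expectation P f"
proof -
  have "(\<integral>\<^sup>+\<omega>. ennreal (f \<omega>) \<partial>P) \<le> K" "(\<integral>\<^sup>+\<omega>. ennreal (- f \<omega>) \<partial>P) \<le> K"
    by (rule order_trans[OF nn_integral_mono assms], simp add: ennreal_leI)+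
  then have "enn2ereal (\<integral>\<^sup>+\<omega>. ennreal (f \<omega>) \<partial>P) \<le> enn2ereal K"
    "enn2ereal (\<integral>\<^sup>+\<omega>. ennreal (- f \<omega>) \<partial>P) \<le> enn2ereal K"
    by (simp_all add: less_eq_ennreal.rep_eq)
  moreover have "a - b \<le> k" "- k \<le> a - b" if "0 \<le> a" "0 \<le> b" "a \<le> k" "b \<le> k" for a b k :: ereal
    using that by (cases a; cases b; cases k; simp)+
  ultimately show "ext_expectation P f \<le> enn2ereal K" "- enn2ereal K \<le> ext_expectation P f"
    by (simp_all add: ext_expectation_def)
qed

lemma ereal_uminus_one_mult: "ereal (- 1) * k = - k"
  by (cases k) auto

text \<open>A positive factor scales the positive and the negative part separately. The case
  analysis shows that it also passes through the difference when parts are infinite.\<close>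

lemma ext_expectation_divide:
  assumes [measurable]: "f \<in> borel_measurable P" and c: "0 < c"
  shows "ext_expectation P (\<lambda>\<omega>. f \<omega> / c) = ext_expectation P f / ereal c"
proof -
  have *: "enn2ereal (\<integral>\<^sup>+\<omega>. ennreal (g \<omega> / c) \<partial>P) = ereal (1 / c) * enn2ereal (\<integral>\<^sup>+\<omega>. ennreal (g \<omega>) \<partial>P)"
    if [measurable]: "g \<in> borel_measurable P" for g
  proof -
    have "ennreal (g \<omega> / c) = ennreal (1 / c) * ennreal (g \<omega>)" for \<omega>
      using c by (subst ennreal_mult'[symmetric]) auto
    then have "(\<integral>\<^sup>+\<omega>. ennreal (g \<omega> / c) \<partial>P) = ennreal (1 / c) * (\<integral>\<^sup>+\<omega>. ennreal (g \<omega>) \<partial>P)"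
      by (simp add: nn_integral_cmult)
    then show ?thesis
      using c by (simp add: times_ennreal.rep_eq)
  qed
  have "ereal (1 / c) * a - ereal (1 / c) * b = (a - b) / ereal c" if "0 \<le> a" "0 \<le> b" for a b
    using that c by (cases a; cases b) (simp_all add: diff_divide_distrib)
  then show ?thesis
    using *[of f] *[of "\<lambda>\<omega>. - f \<omega>"] by (simp add: ext_expectation_def)
qed

section \<open>Bounds and attainment for three symmetric laws\<close>

locale symmetric_laws =
  S1: symmetric_law F1 + S2: symmetric_law F2 + S3: symmetric_law F3 for F1 F2 F3
begin

definition comonotone_product :: "real \<Rightarrow> real" where
  "comonotone_product u = quantile S1.G u * quantile S2.G u * quantile S3.G u"

text \<open>The value is kept in \<open>ennreal\<close> because square integrability does not ensure
  that a product of three quantile functions is integrable; it may be infinite.\<close>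

definition comonotone_moment :: ennreal where
  "comonotone_moment = (\<integral>\<^sup>+u. ennreal (comonotone_product u) \<partial>std_uniform)"

abbreviation standardized_product :: "real \<Rightarrow> real \<Rightarrow> real \<Rightarrow> real" where
  "standardized_product x1 x2 x3 \<equiv> standardize F1 x1 * standardize F2 x2 * standardize F3 x3"

lemma measurable_comonotone_product [measurable]: "comonotone_product \<in> borel_measurable borel"
  unfolding comonotone_product_def by measurable

lemma comonotone_product_nonneg: "0 < u \<Longrightarrow> u < 1 \<Longrightarrow> 0 \<le> comonotone_product u"
  by (simp add: comonotone_product_def S1.quantile_G_nonneg S2.quantile_G_nonneg S3.quantile_G_nonneg)

lemma centred_product_eq:
  assumes "prob_space P" "has_distribution P X1 F1" "has_distribution P X2 F2" "has_distribution P X3 F3"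
  shows "centred_product P X1 X2 X3 \<omega> =
    S1.s * S2.s * S3.s * standardized_product (X1 \<omega>) (X2 \<omega>) (X3 \<omega>)"
  using S1.sd_pos S2.sd_pos S3.sd_pos S1.has_distributionD(3)[OF assms(1,2)]
    S2.has_distributionD(3)[OF assms(1,3)] S3.has_distributionD(3)[OF assms(1,4)]
  by (simp add: centred_product_def)

lemma coskewness_eq:
  assumes "prob_space P" "has_distribution P X1 F1" "has_distribution P X2 F2" "has_distribution P X3 F3"
  shows "coskewness P X1 X2 X3 =
    ext_expectation P (\<lambda>\<omega>. standardized_product (X1 \<omega>) (X2 \<omega>) (X3 \<omega>))"
proof -
  note [measurable] = S1.has_distributionD(1)[OF assms(1,2)]
    S2.has_distributionD(1)[OF assms(1,3)] S3.has_distributionD(1)[OF assms(1,4)]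
  have "centred_product P X1 X2 X3 \<in> borel_measurable P"
    unfolding centred_product_def by measurable
  then have "coskewness P X1 X2 X3 =
      ext_expectation P (\<lambda>\<omega>. centred_product P X1 X2 X3 \<omega> / (S1.s * S2.s * S3.s))"
    using S1.sd_pos S2.sd_pos S3.sd_pos S1.has_distributionD(4)[OF assms(1,2)]
      S2.has_distributionD(4)[OF assms(1,3)] S3.has_distributionD(4)[OF assms(1,4)]
    by (simp add: coskewness_def ext_expectation_divide)
  then show ?thesis
    using S1.sd_pos S2.sd_pos S3.sd_pos by (simp add: centred_product_eq[OF assms])
qed

lemma coskewness_bounds:
  assumes "admissible F1 F2 F3 P X1 X2 X3"
  shows "coskewness P X1 X2 X3 \<le> enn2ereal comonotone_moment"
    "- enn2ereal comonotone_moment \<le> coskewness P X1 X2 X3"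
proof -
  have P: "prob_space P" and X: "has_distribution P X1 F1" "has_distribution P X2 F2" "has_distribution P X3 F3"
    using assms by (auto simp: admissible_def)
  note [measurable] = S1.has_distributionD(1)[OF P X(1)]
    S2.has_distributionD(1)[OF P X(2)] S3.has_distributionD(1)[OF P X(3)]
  have "(\<integral>\<^sup>+\<omega>. ennreal \<bar>standardized_product (X1 \<omega>) (X2 \<omega>) (X3 \<omega>)\<bar> \<partial>P) =
      (\<integral>\<^sup>+\<omega>. ennreal \<bar>standardize F1 (X1 \<omega>)\<bar> *
        (ennreal \<bar>standardize F2 (X2 \<omega>)\<bar> * ennreal \<bar>standardize F3 (X3 \<omega>)\<bar>) \<partial>P)"
    by (simp only: abs_mult ennreal_mult abs_ge_zero mult_nonneg_nonneg mult.assoc)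
  also have "\<dots> \<le> (\<integral>\<^sup>+u. ennreal (quantile S1.G u) *
      (ennreal (quantile S2.G u) * ennreal (quantile S3.G u)) \<partial>std_uniform)"
    by (rule nn_integral_prod3_le_quantile[OF P _ _ _ S1.has_distributionD(5)[OF P X(1)]
        S2.has_distributionD(5)[OF P X(2)] S3.has_distributionD(5)[OF P X(3)]]) measurable
  also have "\<dots> = comonotone_moment"
    unfolding comonotone_moment_def
  proof (rule nn_integral_cong_AE)
    \<comment> \<open>The factors are known to be nonnegative only at interior levels, so merging
      them under one \<open>ennreal\<close> is an almost sure identity.\<close>
    show "AE u in std_uniform. ennreal (quantile S1.G u) *
        (ennreal (quantile S2.G u) * ennreal (quantile S3.G u)) = ennreal (comonotone_product u)"
      using AE_std_uniform[of 0]
      by eventually_elim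
        (simp add: comonotone_product_def ennreal_mult'' mult.assoc
          S1.quantile_G_nonneg S2.quantile_G_nonneg S3.quantile_G_nonneg)
  qed
  finally show "coskewness P X1 X2 X3 \<le> enn2ereal comonotone_moment"
    "- enn2ereal comonotone_moment \<le> coskewness P X1 X2 X3"
    unfolding coskewness_eq[OF P X] by (rule ext_expectation_bounds)+
qed

text \<open>Only the law of \<open>W\<close> matters. The couplings produce the product at
  \<open>\<bar>2 * U - 1\<bar>\<close>, whereas the claimed extremal value uses \<open>U\<close>
  itself; both variables are uniform, so this lemma identifies the two expectations.\<close>

lemma ext_expectation_comonotone_product:
  assumes "prob_space P" and [measurable]: "W \<in> borel_measurable P"
    and W: "distr P borel W = std_uniform"
  shows "expectation_well_defined P (\<lambda>\<omega>. comonotone_product (W \<omega>))"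
    "ext_expectation P (\<lambda>\<omega>. comonotone_product (W \<omega>)) = enn2ereal comonotone_moment"
    "ext_expectation P (\<lambda>\<omega>. - comonotone_product (W \<omega>)) = - enn2ereal comonotone_moment"
    "AE \<omega> in P. 0 \<le> comonotone_product (W \<omega>)"
proof -
  have "AE u in std_uniform. 0 \<le> comonotone_product u"
    using AE_std_uniform[of 0] by eventually_elim (simp add: comonotone_product_nonneg)
  then show nonneg: "AE \<omega> in P. 0 \<le> comonotone_product (W \<omega>)"
    unfolding W[symmetric] by (rule AE_distrD[rotated]) simp
  then show "expectation_well_defined P (\<lambda>\<omega>. comonotone_product (W \<omega>))"
    by (intro expectation_well_defined_AE disjI1) measurable
  have "comonotone_moment = (\<integral>\<^sup>+\<omega>. ennreal (comonotone_product (W \<omega>)) \<partial>P)"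
    unfolding comonotone_moment_def W[symmetric] by (simp add: nn_integral_distr)
  then show "ext_expectation P (\<lambda>\<omega>. comonotone_product (W \<omega>)) = enn2ereal comonotone_moment"
    "ext_expectation P (\<lambda>\<omega>. - comonotone_product (W \<omega>)) = - enn2ereal comonotone_moment"
    using nonneg by (simp_all add: ext_expectation_nonneg)
qed

text \<open>The number \<open>c\<close> is the common sign of the standardized product. A constant
  sign makes the expectation well defined even if it is infinite, which is what admissibility
  requires of the coupling.\<close>

lemma coskewness_attained:
  assumes P: "prob_space P"
    and X: "has_distribution P X1 F1" "has_distribution P X2 F2" "has_distribution P X3 F3"
    and [measurable]: "W \<in> borel_measurable P" and W: "distr P borel W = std_uniform"
    and c: "c = 1 \<or> c = -1"
    and prod: "AE \<omega> in P. standardized_product (X1 \<omega>) (X2 \<omega>) (X3 \<omega>) = c * comonotone_product (W \<omega>)"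
  shows "admissible F1 F2 F3 P X1 X2 X3"
    "coskewness P X1 X2 X3 = ereal c * enn2ereal comonotone_moment"
proof -
  note [measurable] = S1.has_distributionD(1)[OF P X(1)]
    S2.has_distributionD(1)[OF P X(2)] S3.has_distributionD(1)[OF P X(3)]
  note W' = ext_expectation_comonotone_product[OF P \<open>W \<in> _\<close> W]
  have s: "0 < S1.s * S2.s * S3.s"
    using S1.sd_pos S2.sd_pos S3.sd_pos by simp
  have "AE \<omega> in P. centred_product P X1 X2 X3 \<omega> = S1.s * S2.s * S3.s * (c * comonotone_product (W \<omega>))"
    using prod by eventually_elim (simp only: centred_product_eq[OF P X])
  with W'(4) have "AE \<omega> in P. 0 \<le> c * centred_product P X1 X2 X3 \<omega>"
  proof eventually_elim
    case (elim \<omega>)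
    \<comment> \<open>Here \<open>c\<close> squares to 1, so multiplying the centred product by
      \<open>c\<close> leaves a nonnegative quantity.\<close>
    have *: "c * (k * (c * x)) = k * x" for k x
      using c by auto
    show ?case
      unfolding elim(2) * by (rule mult_nonneg_nonneg[OF less_imp_le[OF s] elim(1)])
  qed
  then have "(AE \<omega> in P. 0 \<le> centred_product P X1 X2 X3 \<omega>) \<or> (AE \<omega> in P. centred_product P X1 X2 X3 \<omega> \<le> 0)"
    using c by (elim disjE) simp_all
  moreover have "centred_product P X1 X2 X3 \<in> borel_measurable P"
    unfolding centred_product_def by measurable
  ultimately have "expectation_well_defined P (centred_product P X1 X2 X3)"
    by (intro expectation_well_defined_AE)
  then show "admissible F1 F2 F3 P X1 X2 X3"
    using P X by (simp add: admissible_def)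
  have "coskewness P X1 X2 X3 = ext_expectation P (\<lambda>\<omega>. c * comonotone_product (W \<omega>))"
    unfolding coskewness_eq[OF P X] by (rule ext_expectation_cong_AE[OF prod])
  also have "\<dots> = ereal c * enn2ereal comonotone_moment"
    using c W'(2,3) by (auto simp: ereal_uminus_one_mult)
  finally show "coskewness P X1 X2 X3 = ereal c * enn2ereal comonotone_moment" .
qed

text \<open>The attaining coupling may live on a sample space of any type; its value enters
  \<open>coskewness_values\<close> through its joint law, by
  \<open>admissible_imp_coskewness_value\<close>.\<close>

lemma max_coskewness_eq:
  assumes "admissible F1 F2 F3 P X1 X2 X3" "coskewness P X1 X2 X3 = enn2ereal comonotone_moment"
  shows "max_coskewness F1 F2 F3 = enn2ereal comonotone_moment"
  unfolding max_coskewness_def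
proof (rule antisym)
  show "Sup (coskewness_values F1 F2 F3) \<le> enn2ereal comonotone_moment"
    using coskewness_bounds(1) by (auto intro!: Sup_least simp: coskewness_values_def)
  show "enn2ereal comonotone_moment \<le> Sup (coskewness_values F1 F2 F3)"
    using admissible_imp_coskewness_value[OF assms(1)] assms(2) by (auto intro: Sup_upper)
qed

lemma min_coskewness_eq:
  assumes "admissible F1 F2 F3 P X1 X2 X3" "coskewness P X1 X2 X3 = - enn2ereal comonotone_moment"
  shows "min_coskewness F1 F2 F3 = - enn2ereal comonotone_moment"
  unfolding min_coskewness_def
proof (rule antisym)
  show "- enn2ereal comonotone_moment \<le> Inf (coskewness_values F1 F2 F3)"
    using coskewness_bounds(2) by (auto intro!: Inf_greatest simp: coskewness_values_def)
  show "Inf (coskewness_values F1 F2 F3) \<le> - enn2ereal comonotone_moment"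
    using admissible_imp_coskewness_value[OF assms(1)] assms(2) by (metis Inf_lower)
qed

end

section \<open>The explicit extremal couplings\<close>

theorem proposition4p1:
  fixes F1 F2 F3 G1 G2 G3 :: "real \<Rightarrow> real"
    and P :: "'a measure"
    and U V I J U1 U2 U3 U3' :: "'a \<Rightarrow> real"
  assumes F: "\<forall>F\<in>{F1, F2, F3}. distribution_function F \<and> square_integrable_df F \<and>
                df_sd F > 0 \<and> symmetric_df F"
    and G: "G1 = abs_standardized_df F1" "G2 = abs_standardized_df F2" "G3 = abs_standardized_df F3"
    and P: "prob_space P"
    and U: "U \<in> borel_measurable P" "distr P borel U = uniform_measure lborel {0..1}"
    and V: "V \<in> borel_measurable P" "distr P borel V = uniform_measure lborel {0..1}"
    and UV: "prob_space.indep_var P borel U borel V"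
    and I: "I = (\<lambda>\<omega>. of_bool (U \<omega> > 1/2))"
    and J: "J = (\<lambda>\<omega>. of_bool (V \<omega> > 1/2))"
    and U1: "U1 = U"
    and U2: "U2 = (\<lambda>\<omega>. I \<omega> * J \<omega> * U \<omega> + I \<omega> * (1 - J \<omega>) * (1 - U \<omega>) +
                     (1 - I \<omega>) * J \<omega> * U \<omega> + (1 - I \<omega>) * (1 - J \<omega>) * (1 - U \<omega>))"
    and U3: "U3 = (\<lambda>\<omega>. I \<omega> * J \<omega> * U \<omega> + I \<omega> * (1 - J \<omega>) * (1 - U \<omega>) +
                     (1 - I \<omega>) * J \<omega> * (1 - U \<omega>) + (1 - I \<omega>) * (1 - J \<omega>) * U \<omega>)"
    and U3': "U3' = (\<lambda>\<omega>. I \<omega> * J \<omega> * (1 - U \<omega>) + I \<omega> * (1 - J \<omega>) * U \<omega> +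
                       (1 - I \<omega>) * J \<omega> * U \<omega> + (1 - I \<omega>) * (1 - J \<omega>) * (1 - U \<omega>))"
  shows "expectation_well_defined P
           (\<lambda>\<omega>. quantile G1 (U \<omega>) * quantile G2 (U \<omega>) * quantile G3 (U \<omega>)) \<and>
         max_coskewness F1 F2 F3 =
           ext_expectation P (\<lambda>\<omega>. quantile G1 (U \<omega>) * quantile G2 (U \<omega>) * quantile G3 (U \<omega>)) \<and>
         admissible F1 F2 F3 P
           (\<lambda>\<omega>. quantile F1 (U1 \<omega>)) (\<lambda>\<omega>. quantile F2 (U2 \<omega>)) (\<lambda>\<omega>. quantile F3 (U3 \<omega>)) \<and>
         coskewness P
           (\<lambda>\<omega>. quantile F1 (U1 \<omega>)) (\<lambda>\<omega>. quantile F2 (U2 \<omega>)) (\<lambda>\<omega>. quantile F3 (U3 \<omega>)) =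
           max_coskewness F1 F2 F3 \<and>
         min_coskewness F1 F2 F3 =
           - ext_expectation P (\<lambda>\<omega>. quantile G1 (U \<omega>) * quantile G2 (U \<omega>) * quantile G3 (U \<omega>)) \<and>
         admissible F1 F2 F3 P
           (\<lambda>\<omega>. quantile F1 (U1 \<omega>)) (\<lambda>\<omega>. quantile F2 (U2 \<omega>)) (\<lambda>\<omega>. quantile F3 (U3' \<omega>)) \<and>
         coskewness P
           (\<lambda>\<omega>. quantile F1 (U1 \<omega>)) (\<lambda>\<omega>. quantile F2 (U2 \<omega>)) (\<lambda>\<omega>. quantile F3 (U3' \<omega>)) =
           min_coskewness F1 F2 F3"
proof -
  interpret symmetric_laws F1 F2 F3
    using F by (simp add: symmetric_laws_def symmetric_law_def)
  interpret P: prob_space P by fact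
  note [measurable] = U(1) V(1)
  note dU = U(2)[folded std_uniform_def] and dV = V(2)[folded std_uniform_def]
  \<comment> \<open>\<open>f\<close> folds a level into the upper half of the unit interval and
    \<open>f'\<close> into the lower half. The four-term formulas then become fair-coin choices
    between a level and its reflection, with the identity in the role of \<open>f\<close> for
    \<open>U2\<close>.\<close>
  define f f' :: "real \<Rightarrow> real"
    where "f u = (if u > 1/2 then u else 1 - u)" and "f' u = (if u > 1/2 then 1 - u else u)" for u
  have [measurable]: "f \<in> borel_measurable borel" "f' \<in> borel_measurable borel"
    unfolding f_def[abs_def] f'_def[abs_def] by measurable
  have Ueq: "U2 = (\<lambda>\<omega>. if V \<omega> > 1/2 then U \<omega> else 1 - U \<omega>)"
    "U3 = (\<lambda>\<omega>. if V \<omega> > 1/2 then f (U \<omega>) else 1 - f (U \<omega>))"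
    "U3' = (\<lambda>\<omega>. if V \<omega> > 1/2 then f' (U \<omega>) else 1 - f' (U \<omega>))"
    by (auto simp: fun_eq_iff U2 U3 U3' I J f_def f'_def)
  have [measurable]: "U1 \<in> borel_measurable P" "U2 \<in> borel_measurable P" "U3 \<in> borel_measurable P"
    "U3' \<in> borel_measurable P"
    unfolding U1 Ueq by measurable
  have d: "distr P borel U1 = std_uniform" "distr P borel U2 = std_uniform"
    "distr P borel U3 = std_uniform" "distr P borel U3' = std_uniform"
    unfolding U1 Ueq
    by (rule dU distr_coin_reflect[OF P U(1) dU V(1) dV UV, of "\<lambda>u. u"]
        distr_coin_reflect[OF P U(1) dU V(1) dV UV]; simp add: f_def f'_def)+
  \<comment> \<open>Each coupling variable is \<open>U\<close> or \<open>1 - U\<close>, so all of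
    them fold to this same level: the absolute values are comonotone.\<close>
  define W where "W = (\<lambda>\<omega>. \<bar>2 * U \<omega> - 1\<bar>)"
  have W: "W \<in> borel_measurable P" "distr P borel W = std_uniform"
    using distr_distr[of "\<lambda>u. \<bar>2 * u - 1\<bar>" borel borel U P]
    by (simp_all add: W_def dU distr_std_uniform_fold comp_def)
  have AE_U: "AE \<omega> in P. Q (U \<omega>)" if "AE u in std_uniform. Q u" for Q
    using that unfolding dU[symmetric] by (rule AE_distrD[rotated]) simp
  have X: "has_distribution P (\<lambda>\<omega>. quantile F1 (U1 \<omega>)) F1" "has_distribution P (\<lambda>\<omega>. quantile F2 (U2 \<omega>)) F2"
    "has_distribution P (\<lambda>\<omega>. quantile F3 (U3 \<omega>)) F3" "has_distribution P (\<lambda>\<omega>. quantile F3 (U3' \<omega>)) F3"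
    by (auto intro!: S1.has_distribution_quantile S2.has_distribution_quantile S3.has_distribution_quantile d)
  note Z = AE_U[OF S1.AE_standardize_quantile] AE_U[OF S2.AE_standardize_quantile]
    AE_U[OF S3.AE_standardize_quantile]
  \<comment> \<open>Let e be the sign of \<open>U - 1/2\<close>, and let h be 1 if
    \<open>V > 1/2\<close> and -1 otherwise. The three factors carry the signs e, e h and h, whose
    product is 1.\<close>
  have "AE \<omega> in P. standardized_product (quantile F1 (U1 \<omega>)) (quantile F2 (U2 \<omega>)) (quantile F3 (U3 \<omega>)) =
      1 * comonotone_product (W \<omega>)"
    using Z by eventually_elim (simp add: U1 Ueq f_def comonotone_product_def W_def
        del: times_divide_eq_left times_divide_eq_right)
  note max = coskewness_attained[OF P X(1,2,3) W _ this]
  \<comment> \<open>With \<open>f'\<close> in place of \<open>f\<close> the third sign becomes -h,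
    so the product of the signs is -1.\<close>
  have "AE \<omega> in P. standardized_product (quantile F1 (U1 \<omega>)) (quantile F2 (U2 \<omega>)) (quantile F3 (U3' \<omega>)) =
      -1 * comonotone_product (W \<omega>)"
    using Z by eventually_elim (simp add: U1 Ueq f'_def comonotone_product_def W_def
        del: times_divide_eq_left times_divide_eq_right)
  note min = coskewness_attained[OF P X(1,2,4) W _ this]
  have G_eq: "(\<lambda>\<omega>. quantile G1 (U \<omega>) * quantile G2 (U \<omega>) * quantile G3 (U \<omega>)) =
      (\<lambda>\<omega>. comonotone_product (U \<omega>))"
    by (simp add: G comonotone_product_def)
  note min = min[unfolded ereal_uminus_one_mult]
  show ?thesis
    unfolding G_eq ext_expectation_comonotone_product(2)[OF P U(1) dU]
    using ext_expectation_comonotone_product(1)[OF P U(1) dU] max min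
      max_coskewness_eq[OF max(1)] min_coskewness_eq[OF min(1)]
    by simp
qed

end
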